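(* Let $n\ge 1$. A Menger algebra $(G,o)$ of rank $n$ is isomorphic to a Menger algebra of $n$-place interior operations on some set if and only if it is derived from an idempotent commutative semigroup, i.e. its diagonal semigroup $(G,* )$ is idempotent and commutative and $(G,o)$ is derived from $(G,* )$.
   Context: A Menger algebra of rank $n$ is a nonempty set $G$ with an $(n+1)$-ary operation $o\colon (f,g_1,\ldots,g_n)\mapsto f[g_1\ldots g_n]$ satisfying the superassociative law $f[g_1\ldots g_n][h_1\ldots h_n]=f[g_1[h_1\ldots h_n]\ldots g_n[h_1\ldots h_n]]$ (iterated brackets are read from left to right). Its diagonal semigroup is $(G,* )$ with $x*y=x[y\ldots y]$ ($n$ copies of $y$), which is a semigroup. $(G,o)$ is derived from its diagonal semigroup if $f[g_1g_2\ldots g_n]=f*g_1*g_2*\cdots*g_n$ for all $f,g_1,\ldots,g_n\in G$. A semigroup is idempotent if $x*x=x$ for all $x$. For a nonempty set $A$, $\mathfrak{P}(A)$ is the family of all subsets of $A$ and $\mathcal{T}_n(\mathfrak{P}(A))$ is the set of all maps $f\colon \mathfrak{P}(A)^n\to\mathfrak{P}(A)$ ($n$-place transformations of $\mathfrak{P}(A)$). The Menger superposition is $f[g_1\ldots g_n](X_1,\ldots,X_n)=f(g_1(X_1,\ldots,X_n),\ldots,g_n(X_1,\ldots,X_n))$. An $n$-place transformation $f$ is contractive if $f(X_1,\ldots,X_n)\subseteq X_1\cap\dots\cap X_n$ for all $X_1,\ldots,X_n$; idempotent if $f[f\ldots f]=f$; isotone if $X_1\subseteq Y_1,\ldots,X_n\subseteq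 Y_n$ imply $f(X_1,\ldots,X_n)\subseteq f(Y_1,\ldots,Y_n)$. An $n$-place interior operation on $A$ is an $n$-place transformation of $\mathfrak{P}(A)$ that is contractive, idempotent and isotone. A Menger algebra of $n$-place interior operations on $A$ is a nonempty set $\Phi\subseteq\mathcal{T}_n(\mathfrak{P}(A))$, all of whose elements are $n$-place interior operations on $A$, closed under Menger superposition and equipped with it as operation. An isomorphism of Menger algebras of rank $n$ is a bijection $P$ with $P(g[g_1\ldots g_n])=P(g)[P(g_1)\ldots P(g_n)]$. *)

theory Defs
  imports Main "HOL-Library.FuncSet" "HOL-Library.NList"
begin

text \<open>
  Algebras are carrier sets with an operation on an ambient type. An \<open>(n+1)\<close>-ary operation
  is a function \<open>'a \<Rightarrow> 'a list \<Rightarrow> 'a\<close>, with \<open>f[g\<^sub>1 \<dots> g\<^sub>n]\<close> written \<open>opr f [g\<^sub>1, \<dots>, g\<^sub>n]\<close>;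
  only its values on \<open>G\<close> and on argument lists in \<open>nlists n G\<close> (lists of length \<open>n\<close> over \<open>G\<close>)
  matter.
\<close>

definition menger_algebra :: "nat \<Rightarrow> 'a set \<Rightarrow> ('a \<Rightarrow> 'a list \<Rightarrow> 'a) \<Rightarrow> bool" where
  "menger_algebra n G opr \<longleftrightarrow>
     G \<noteq> {} \<and>
     (\<forall>f\<in>G. \<forall>gs\<in>nlists n G. opr f gs \<in> G) \<and>
     (\<forall>f\<in>G. \<forall>gs\<in>nlists n G. \<forall>hs\<in>nlists n G.
        opr (opr f gs) hs = opr f (map (\<lambda>g. opr g hs) gs))"

definition diagonal :: "nat \<Rightarrow> ('a \<Rightarrow> 'a list \<Rightarrow> 'a) \<Rightarrow> 'a \<Rightarrow> 'a \<Rightarrow> 'a" where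
  "diagonal n opr x y = opr x (replicate n y)"

definition semigroup_on :: "'a set \<Rightarrow> ('a \<Rightarrow> 'a \<Rightarrow> 'a) \<Rightarrow> bool" where
  "semigroup_on G m \<longleftrightarrow>
     G \<noteq> {} \<and> (\<forall>x\<in>G. \<forall>y\<in>G. m x y \<in> G) \<and>
     (\<forall>x\<in>G. \<forall>y\<in>G. \<forall>z\<in>G. m (m x y) z = m x (m y z))"

definition commutative_on :: "'a set \<Rightarrow> ('a \<Rightarrow> 'a \<Rightarrow> 'a) \<Rightarrow> bool" where
  "commutative_on G m \<longleftrightarrow> (\<forall>x\<in>G. \<forall>y\<in>G. m x y = m y x)"

definition idempotent_on :: "'a set \<Rightarrow> ('a \<Rightarrow> 'a \<Rightarrow> 'a) \<Rightarrow> bool" where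
  "idempotent_on G m \<longleftrightarrow> (\<forall>x\<in>G. m x x = x)"

text \<open>\<open>foldl m f [g\<^sub>1, \<dots>, g\<^sub>n]\<close> is \<open>(\<dots>((f * g\<^sub>1) * g\<^sub>2) * \<dots>) * g\<^sub>n\<close>.\<close>

definition derived_from_diagonal :: "nat \<Rightarrow> 'a set \<Rightarrow> ('a \<Rightarrow> 'a list \<Rightarrow> 'a) \<Rightarrow> bool" where
  "derived_from_diagonal n G opr \<longleftrightarrow>
     (\<forall>f\<in>G. \<forall>gs\<in>nlists n G. opr f gs = foldl (diagonal n opr) f gs)"

definition derived_from_idem_comm_semigroup ::
    "nat \<Rightarrow> 'a set \<Rightarrow> ('a \<Rightarrow> 'a list \<Rightarrow> 'a) \<Rightarrow> bool" where
  "derived_from_idem_comm_semigroup n G opr \<longleftrightarrow>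
     semigroup_on G (diagonal n opr) \<and>
     idempotent_on G (diagonal n opr) \<and>
     commutative_on G (diagonal n opr) \<and>
     derived_from_diagonal n G opr"

text \<open>
  Transformations of the power set of \<open>A\<close> are taken extensional (\<open>undefined\<close> off the
  \<open>n\<close>-tuples of subsets of \<open>A\<close>), so that equality of HOL functions is equality of maps
  \<open>Pow A\<^sup>n \<rightarrow> Pow A\<close>.
\<close>

definition transformations :: "nat \<Rightarrow> 'a set \<Rightarrow> ('a set list \<Rightarrow> 'a set) set" where
  "transformations n A = nlists n (Pow A) \<rightarrow>\<^sub>E Pow A"

definition superposition ::
    "nat \<Rightarrow> 'a set \<Rightarrow> ('a set list \<Rightarrow> 'a set) \<Rightarrow> ('a set list \<Rightarrow> 'a set) list
      \<Rightarrow> ('a set list \<Rightarrow> 'a set)" where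
  "superposition n A f gs = (\<lambda>Xs\<in>nlists n (Pow A). f (map (\<lambda>g. g Xs) gs))"

definition contractive :: "nat \<Rightarrow> 'a set \<Rightarrow> ('a set list \<Rightarrow> 'a set) \<Rightarrow> bool" where
  "contractive n A f \<longleftrightarrow> (\<forall>Xs\<in>nlists n (Pow A). f Xs \<subseteq> \<Inter>(set Xs))"

definition idempotent_transformation ::
    "nat \<Rightarrow> 'a set \<Rightarrow> ('a set list \<Rightarrow> 'a set) \<Rightarrow> bool" where
  "idempotent_transformation n A f \<longleftrightarrow> superposition n A f (replicate n f) = f"

definition isotone :: "nat \<Rightarrow> 'a set \<Rightarrow> ('a set list \<Rightarrow> 'a set) \<Rightarrow> bool" where
  "isotone n A f \<longleftrightarrow>
     (\<forall>Xs\<in>nlists n (Pow A). \<forall>Ys\<in>nlists n (Pow A). list_all2 (\<subseteq>) Xs Ys \<longrightarrow> f Xs \<subseteq> f Ys)"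

definition interior_operation :: "nat \<Rightarrow> 'a set \<Rightarrow> ('a set list \<Rightarrow> 'a set) \<Rightarrow> bool" where
  "interior_operation n A f \<longleftrightarrow>
     f \<in> transformations n A \<and> contractive n A f \<and> idempotent_transformation n A f \<and>
     isotone n A f"

definition interior_menger_algebra ::
    "nat \<Rightarrow> 'a set \<Rightarrow> ('a set list \<Rightarrow> 'a set) set \<Rightarrow> bool" where
  "interior_menger_algebra n A \<Phi> \<longleftrightarrow>
     A \<noteq> {} \<and> \<Phi> \<noteq> {} \<and> (\<forall>f\<in>\<Phi>. interior_operation n A f) \<and>
     (\<forall>f\<in>\<Phi>. \<forall>gs\<in>nlists n \<Phi>. superposition n A f gs \<in> \<Phi>)"

definition menger_isomorphic ::
    "nat \<Rightarrow> 'a set \<Rightarrow> ('a \<Rightarrow> 'a list \<Rightarrow> 'a) \<Rightarrow> 'b set \<Rightarrow> ('b \<Rightarrow> 'b list \<Rightarrow> 'b) \<Rightarrow> bool" where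
  "menger_isomorphic n G opr H opr' \<longleftrightarrow>
     (\<exists>P. bij_betw P G H \<and>
          (\<forall>g\<in>G. \<forall>gs\<in>nlists n G. P (opr g gs) = opr' (P g) (map P gs)))"

definition isomorphic_to_interior_operations_on ::
    "nat \<Rightarrow> 'a set \<Rightarrow> ('a \<Rightarrow> 'a list \<Rightarrow> 'a) \<Rightarrow> 'b set \<Rightarrow> bool" where
  "isomorphic_to_interior_operations_on n G opr A \<longleftrightarrow>
     (\<exists>\<Phi>. interior_menger_algebra n A \<Phi> \<and> menger_isomorphic n G opr \<Phi> (superposition n A))"

end

theory Submission
  imports Defs
begin

text \<open>
  Both sides of the equivalence say that \<open>G\<close> carries an order in which \<open>f[g\<^sub>1 \<dots> g\<^sub>n]\<close> is the greatest
  lower bound of \<open>f, g\<^sub>1, \<dots>, g\<^sub>n\<close>; this is the predicate \<open>operation_is_meet\<close> below.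

  For interior operations the order is pointwise inclusion. Superposition then yields a lower bound
  because the operations are contractive and isotone, and it yields the greatest one because an
  interior operation \<open>h\<close> below all of \<open>f, g\<^sub>1, \<dots>, g\<^sub>n\<close> satisfies
  \<open>h(X) = h(h(X), \<dots>, h(X)) \<subseteq> f(g\<^sub>1(X), \<dots>, g\<^sub>n(X))\<close> (\<open>superposition_is_meet\<close>).

  An operation of this kind is the iterated product of its diagonal semigroup, which is
  a semilattice, since greatest lower bounds are idempotent, commutative and associative
  (\<open>derived_if_meet\<close>). Conversely, a semilattice has its natural order, \<open>x \<le> y\<close> iff \<open>x * y = x\<close>
  (\<open>meet_if_derived\<close>). Finally, if the operation of \<open>G\<close> is a meet, then sending \<open>g\<close> to
  \<open>(X\<^sub>1, \<dots>, X\<^sub>n) \<mapsto> {x \<in> X\<^sub>1 \<inter> \<dots> \<inter> X\<^sub>n. x \<le> g}\<close> represents \<open>G\<close> faithfully by interior operations on the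
  set \<open>G\<close> itself, because the elements below a meet are those below all of its arguments
  (\<open>interior_representation_if_meet\<close>).
\<close>

text \<open>
  Reflexivity and antisymmetry make an element determined by the elements below it, so the last
  clause pins down the operation. For \<open>n \<ge> 1\<close> the clauses entail that \<open>le\<close> is transitive: if \<open>x\<close> is below
  \<open>y\<close>, then \<open>x[y \<dots> y] = x\<close>, and everything below \<open>x[y \<dots> y]\<close> is below \<open>y\<close>.
\<close>

definition operation_is_meet ::
    "nat \<Rightarrow> 'a set \<Rightarrow> ('a \<Rightarrow> 'a list \<Rightarrow> 'a) \<Rightarrow> ('a \<Rightarrow> 'a \<Rightarrow> bool) \<Rightarrow> bool" where
  "operation_is_meet n G opr le \<longleftrightarrow>
     (\<forall>x\<in>G. le x x) \<and>
     (\<forall>x\<in>G. \<forall>y\<in>G. le x y \<and> le y x \<longrightarrow> x = y) \<and>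
     (\<forall>f\<in>G. \<forall>gs\<in>nlists n G. opr f gs \<in> G) \<and>
     (\<forall>f\<in>G. \<forall>gs\<in>nlists n G. \<forall>z\<in>G. le z (opr f gs) \<longleftrightarrow> le z f \<and> (\<forall>g\<in>set gs. le z g))"

text \<open>
  As simplification rules, these two loop against the definition of \<open>nlists\<close>: the set or the
  length in their premise is not determined by their conclusion, and unfolding the premise brings the
  conclusion back.
\<close>

declare nlistsE_length [simp del] nlistsE_set [simp del]

lemma replicate_in_nlists: "x \<in> A \<Longrightarrow> replicate n x \<in> nlists n A"
  by (auto simp: nlists_def)

lemma operation_is_meet_eqI:
  assumes "operation_is_meet n G opr le" "x \<in> G" "y \<in> G" "\<And>z. z \<in> G \<Longrightarrow> le z x \<longleftrightarrow> le z y"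
  shows "x = y"
  using assms unfolding operation_is_meet_def by blast

lemma operation_is_meet_closed:
  assumes "operation_is_meet n G opr le" "f \<in> G" "gs \<in> nlists n G"
  shows "opr f gs \<in> G"
  using assms unfolding operation_is_meet_def by blast

lemma operation_is_meet_iff:
  assumes "operation_is_meet n G opr le" "f \<in> G" "gs \<in> nlists n G" "z \<in> G"
  shows "le z (opr f gs) \<longleftrightarrow> le z f \<and> (\<forall>g\<in>set gs. le z g)"
  using assms unfolding operation_is_meet_def by blast

lemma derived_if_meet:
  assumes n: "n \<ge> 1" and ne: "G \<noteq> {}" and meet: "operation_is_meet n G opr le"
  shows "derived_from_idem_comm_semigroup n G opr"
proof -
  let ?d = "diagonal n opr"
  have closed: "?d x y \<in> G" if "x \<in> G" "y \<in> G" for x y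
    unfolding diagonal_def
    using operation_is_meet_closed[OF meet] that by (simp add: replicate_in_nlists)
  have le_d: "le z (?d x y) \<longleftrightarrow> le z x \<and> le z y" if "x \<in> G" "y \<in> G" "z \<in> G" for x y z
    unfolding diagonal_def
    using operation_is_meet_iff[OF meet] that n by (simp add: replicate_in_nlists)
  have fold: "foldl ?d f gs \<in> G \<and> (\<forall>z\<in>G. le z (foldl ?d f gs) \<longleftrightarrow> le z f \<and> (\<forall>g\<in>set gs. le z g))"
    if "f \<in> G" "set gs \<subseteq> G" for f gs
    using that by (induction gs arbitrary: f) (auto simp: closed le_d)
  note eqI = operation_is_meet_eqI[OF meet]
  have assoc: "?d (?d x y) z = ?d x (?d y z)" if "x \<in> G" "y \<in> G" "z \<in> G" for x y z
    using that by (intro eqI) (auto simp: closed le_d)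
  have comm: "?d x y = ?d y x" if "x \<in> G" "y \<in> G" for x y
    using that by (intro eqI) (auto simp: closed le_d)
  have idem: "?d x x = x" if "x \<in> G" for x
    using that by (intro eqI) (auto simp: closed le_d)
  have opr: "opr f gs = foldl ?d f gs" if "f \<in> G" "gs \<in> nlists n G" for f gs
  proof (rule eqI)
    have gs: "set gs \<subseteq> G"
      using that by (simp add: nlists_def)
    show "opr f gs \<in> G"
      using that by (rule operation_is_meet_closed[OF meet])
    show "foldl ?d f gs \<in> G"
      using fold[OF that(1) gs] by (rule conjunct1)
    show "le z (opr f gs) \<longleftrightarrow> le z (foldl ?d f gs)" if "z \<in> G" for z
      using operation_is_meet_iff[OF meet \<open>f \<in> G\<close> \<open>gs \<in> nlists n G\<close> that] fold[OF \<open>f \<in> G\<close> gs] that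
      by simp
  qed
  have "semigroup_on G ?d"
    using ne closed assoc by (simp add: semigroup_on_def)
  moreover have "commutative_on G ?d"
    using comm unfolding commutative_on_def by blast
  moreover have "idempotent_on G ?d"
    using idem by (simp add: idempotent_on_def)
  moreover have "derived_from_diagonal n G opr"
    unfolding derived_from_diagonal_def by (intro ballI opr)
  ultimately show ?thesis
    by (simp add: derived_from_idem_comm_semigroup_def)
qed

lemma meet_if_derived:
  assumes "derived_from_idem_comm_semigroup n G opr"
  shows "operation_is_meet n G opr (\<lambda>x y. diagonal n opr x y = x)"
proof -
  let ?d = "diagonal n opr"
  have closed: "?d x y \<in> G" if "x \<in> G" "y \<in> G" for x y
    using assms that by (simp add: derived_from_idem_comm_semigroup_def semigroup_on_def)
  have assoc: "?d (?d x y) z = ?d x (?d y z)" if "x \<in> G" "y \<in> G" "z \<in> G" for x y z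
    using assms that by (simp add: derived_from_idem_comm_semigroup_def semigroup_on_def)
  have comm: "?d x y = ?d y x" if "x \<in> G" "y \<in> G" for x y
    using assms that by (simp add: derived_from_idem_comm_semigroup_def commutative_on_def)
  have idem: "?d x x = x" if "x \<in> G" for x
    using assms that by (simp add: derived_from_idem_comm_semigroup_def idempotent_on_def)
  have le_d: "?d z (?d x y) = z \<longleftrightarrow> ?d z x = z \<and> ?d z y = z" if "x \<in> G" "y \<in> G" "z \<in> G" for x y z
  proof
    assume z: "?d z (?d x y) = z"
    have "?d z x = z"
      using assoc[of z "?d y x" x] assoc[of y x x] idem[of x] comm[of x y] closed that z by simp
    moreover have "?d z y = z"
      using assoc[of z "?d x y" y] assoc[of x y y] idem[of y] closed that z by simp
    ultimately show "?d z x = z \<and> ?d z y = z" ..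
  next
    assume "?d z x = z \<and> ?d z y = z"
    then show "?d z (?d x y) = z"
      using assoc[of z x y] that by simp
  qed
  have fold: "foldl ?d f gs \<in> G \<and>
      (\<forall>z\<in>G. ?d z (foldl ?d f gs) = z \<longleftrightarrow> ?d z f = z \<and> (\<forall>g\<in>set gs. ?d z g = z))"
    if "f \<in> G" "set gs \<subseteq> G" for f gs
    using that by (induction gs arbitrary: f) (auto simp: closed le_d)
  have opr: "opr f gs = foldl ?d f gs" if "f \<in> G" "gs \<in> nlists n G" for f gs
    using assms that by (simp add: derived_from_idem_comm_semigroup_def derived_from_diagonal_def)
  have "x = y" if "x \<in> G" "y \<in> G" "?d x y = x" "?d y x = y" for x y
    using comm[of x y] that by simp
  moreover have "opr f gs \<in> G" if "f \<in> G" "gs \<in> nlists n G" for f gs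
    using fold[of f gs] opr that by (simp add: nlists_def)
  moreover have "?d z (opr f gs) = z \<longleftrightarrow> ?d z f = z \<and> (\<forall>g\<in>set gs. ?d z g = z)"
    if "f \<in> G" "gs \<in> nlists n G" "z \<in> G" for f gs z
    using fold[of f gs] opr that by (simp add: nlists_def)
  ultimately show ?thesis
    using idem unfolding operation_is_meet_def by blast
qed

text \<open>
  Since \<open>f\<close> is contractive, \<open>f(g\<^sub>1(X), \<dots>, g\<^sub>n(X))\<close> lies in every \<open>g\<^sub>i(X)\<close>; since the \<open>g\<^sub>i\<close> are contractive
  and \<open>f\<close> is isotone, it lies in \<open>f(X)\<close>. A common lower bound \<open>h\<close> is below the superposition because
  idempotence lets it be applied twice: once to bound the arguments by the \<open>g\<^sub>i\<close>, once to pass to \<open>f\<close>.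
\<close>

lemma superposition_is_meet:
  assumes f: "interior_operation n A f" and gs: "gs \<in> nlists n {g. interior_operation n A g}"
    and h: "interior_operation n A h"
  shows "(\<forall>Xs\<in>nlists n (Pow A). h Xs \<subseteq> superposition n A f gs Xs) \<longleftrightarrow>
    (\<forall>Xs\<in>nlists n (Pow A). h Xs \<subseteq> f Xs) \<and> (\<forall>g\<in>set gs. \<forall>Xs\<in>nlists n (Pow A). h Xs \<subseteq> g Xs)"
    (is "?below_sup \<longleftrightarrow> ?below_f \<and> ?below_gs")
proof -
  have len: "length gs = n" and int_gs: "\<And>g. g \<in> set gs \<Longrightarrow> interior_operation n A g"
    using gs by (auto simp: nlists_def)
  have maps: "k Xs \<in> Pow A" if "interior_operation n A k" "Xs \<in> nlists n (Pow A)" for k Xs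
    using that by (auto simp: interior_operation_def transformations_def)
  have iso_f: "f Xs \<subseteq> f Ys"
    if "Xs \<in> nlists n (Pow A)" "Ys \<in> nlists n (Pow A)" "list_all2 (\<subseteq>) Xs Ys" for Xs Ys
    using f that by (simp add: interior_operation_def isotone_def)
  have contr: "k Xs \<subseteq> X"
    if "interior_operation n A k" "Xs \<in> nlists n (Pow A)" "X \<in> set Xs" for k Xs X
    using that by (auto simp: interior_operation_def contractive_def)
  have args: "map (\<lambda>g. g Xs) gs \<in> nlists n (Pow A)" if "Xs \<in> nlists n (Pow A)" for Xs
    using maps int_gs len that by (auto simp: nlists_def)
  have sup: "superposition n A f gs Xs = f (map (\<lambda>g. g Xs) gs)" if "Xs \<in> nlists n (Pow A)" for Xs
    using that by (simp add: superposition_def)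
  have sup_f: "superposition n A f gs Xs \<subseteq> f Xs" if Xs: "Xs \<in> nlists n (Pow A)" for Xs
  proof -
    have "length Xs = n"
      using Xs by (simp add: nlists_def)
    then have "list_all2 (\<subseteq>) (map (\<lambda>g. g Xs) gs) Xs"
      unfolding list_all2_conv_all_nth using contr[OF int_gs Xs] len by simp
    then show ?thesis
      using iso_f[OF args[OF Xs] Xs] by (simp add: sup[OF Xs])
  qed
  have sup_g: "superposition n A f gs Xs \<subseteq> g Xs" if "Xs \<in> nlists n (Pow A)" "g \<in> set gs" for Xs g
    using contr[OF f args[OF that(1)], of "g Xs"] that by (simp add: sup)
  have "h Xs \<subseteq> superposition n A f gs Xs"
    if "?below_f" "?below_gs" and Xs: "Xs \<in> nlists n (Pow A)" for Xs
  proof -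
    let ?hs = "replicate n (h Xs)"
    have hs: "?hs \<in> nlists n (Pow A)"
      using maps[OF h Xs] by (rule replicate_in_nlists)
    have "h Xs = superposition n A h (replicate n h) Xs"
      using h by (simp add: interior_operation_def idempotent_transformation_def)
    also have "\<dots> = h ?hs"
      using Xs by (simp add: superposition_def)
    also have "\<dots> \<subseteq> f ?hs"
      using that(1) hs by blast
    also have "\<dots> \<subseteq> f (map (\<lambda>g. g Xs) gs)"
      using that(2) Xs len by (intro iso_f hs args) (auto simp: list_all2_conv_all_nth)
    finally show ?thesis
      by (simp add: sup[OF Xs])
  qed
  then have "?below_f \<Longrightarrow> ?below_gs \<Longrightarrow> ?below_sup"
    by (intro ballI)
  moreover have "?below_f \<and> ?below_gs" if ?below_sup
    using that sup_f sup_g by (meson subset_trans)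
  ultimately show ?thesis
    by (intro iffI) simp_all
qed

lemma meet_if_isomorphic_to_interior_operations:
  assumes alg: "menger_algebra n G opr" and isom: "isomorphic_to_interior_operations_on n G opr A"
  obtains le where "operation_is_meet n G opr le"
proof -
  obtain \<Phi> P where \<Phi>: "interior_menger_algebra n A \<Phi>" and bij: "bij_betw P G \<Phi>"
    and hom: "\<And>g gs. g \<in> G \<Longrightarrow> gs \<in> nlists n G \<Longrightarrow>
      P (opr g gs) = superposition n A (P g) (map P gs)"
    using isom by (auto simp: isomorphic_to_interior_operations_on_def menger_isomorphic_def)
  define le where "le x y \<longleftrightarrow> (\<forall>Xs\<in>nlists n (Pow A). P x Xs \<subseteq> P y Xs)" for x y
  have int_P: "interior_operation n A (P x)" if "x \<in> G" for x
    using \<Phi> bij that by (auto simp: interior_menger_algebra_def bij_betw_def)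
  have "x = y" if "x \<in> G" "y \<in> G" "le x y" "le y x" for x y
  proof -
    have "P x \<in> nlists n (Pow A) \<rightarrow>\<^sub>E Pow A" "P y \<in> nlists n (Pow A) \<rightarrow>\<^sub>E Pow A"
      using int_P that by (simp_all add: interior_operation_def transformations_def)
    then have "P x = P y"
      by (rule PiE_ext) (use that in \<open>auto simp: le_def\<close>)
    then show ?thesis
      using bij that by (auto simp: bij_betw_def inj_on_def)
  qed
  moreover have "le z (opr f gs) \<longleftrightarrow> le z f \<and> (\<forall>g\<in>set gs. le z g)"
    if "f \<in> G" "gs \<in> nlists n G" "z \<in> G" for f gs z
  proof -
    have "map P gs \<in> nlists n {g. interior_operation n A g}"
      using that int_P by (auto simp: nlists_def)
    from superposition_is_meet[OF int_P[OF that(1)] this int_P[OF that(3)]] show ?thesis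
      by (simp add: le_def hom that)
  qed
  moreover have "opr f gs \<in> G" if "f \<in> G" "gs \<in> nlists n G" for f gs
    using alg that by (simp add: menger_algebra_def)
  moreover have "le x x" for x
    by (simp add: le_def)
  ultimately have "operation_is_meet n G opr le"
    unfolding operation_is_meet_def by blast
  then show thesis
    by (rule that)
qed

lemma interior_representation_if_meet:
  assumes n: "n \<ge> 1" and ne: "G \<noteq> {}" and meet: "operation_is_meet n G opr le"
  shows "isomorphic_to_interior_operations_on n G opr G"
proof -
  define P where "P g = (\<lambda>Xs\<in>nlists n (Pow G). {x \<in> \<Inter>(set Xs). le x g})" for g
  have P_apply: "P g Xs = {x \<in> \<Inter>(set Xs). le x g}" if "Xs \<in> nlists n (Pow G)" for g Xs
    using that by (simp add: P_def)
  have sub: "\<Inter>(set Xs) \<subseteq> G" if Xs: "Xs \<in> nlists n (Pow G)" for Xs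
  proof -
    have "set Xs \<noteq> {}" "set Xs \<subseteq> Pow G"
      using n Xs by (auto simp: nlists_def)
    then show ?thesis
      by (meson Inf_less_eq PowD subsetD)
  qed
  have P_in: "P g Xs \<in> Pow G" if "Xs \<in> nlists n (Pow G)" for g Xs
    using sub that by (auto simp: P_apply)
  have sup: "superposition n G (P f) (map P gs) Xs =
      {x \<in> \<Inter>(set Xs). le x f \<and> (\<forall>g\<in>set gs. le x g)}"
    if gs: "length gs = n" and Xs: "Xs \<in> nlists n (Pow G)" for f gs Xs
  proof -
    have "map (\<lambda>p. p Xs) (map P gs) \<in> nlists n (Pow G)"
      using gs P_in[OF Xs] by (auto simp: nlists_def)
    then have "superposition n G (P f) (map P gs) Xs = {x \<in> \<Inter>g\<in>set gs. P g Xs. le x f}"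
      using Xs by (simp add: superposition_def P_apply image_image)
    \<comment> \<open>The bound \<open>\<Inter>(set Xs)\<close> is inherited from any one of the arguments, so there must be one.\<close>
    moreover obtain g where "g \<in> set gs"
      using gs n by (cases gs) auto
    ultimately show ?thesis
      using Xs by (auto simp: P_apply)
  qed
  have hom: "P (opr g gs) = superposition n G (P g) (map P gs)"
    if g: "g \<in> G" and gs: "gs \<in> nlists n G" for g gs
  proof
    fix Xs
    show "P (opr g gs) Xs = superposition n G (P g) (map P gs) Xs"
    proof (cases "Xs \<in> nlists n (Pow G)")
      case True
      have "le x (opr g gs) \<longleftrightarrow> le x g \<and> (\<forall>g\<in>set gs. le x g)" if "x \<in> \<Inter>(set Xs)" for x
        using operation_is_meet_iff[OF meet g gs] sub[OF True] that by blast
      moreover have "length gs = n"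
        using gs by (simp add: nlists_def)
      ultimately show ?thesis
        using True by (auto simp: sup P_apply)
    qed (simp add: P_def superposition_def)
  qed
  have inj: "inj_on P G"
  proof (rule inj_onI)
    fix x y
    assume xy: "x \<in> G" "y \<in> G" "P x = P y"
    \<comment> \<open>The value at \<open>(G, \<dots>, G)\<close> is the principal ideal.\<close>
    have "P g (replicate n G) = {x \<in> G. le x g}" for g
      using n by (subst P_apply) (auto simp: replicate_in_nlists)
    then have "{z \<in> G. le z x} = {z \<in> G. le z y}"
      using xy by metis
    then show "x = y"
      using xy by (intro operation_is_meet_eqI[OF meet]) auto
  qed
  have interior: "interior_operation n G (P g)" for g
  proof -
    have "P g \<in> transformations n G"
      unfolding transformations_def
    proof (rule PiE_I)
      show "P g Xs = undefined" if "Xs \<notin> nlists n (Pow G)" for Xs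
        using that by (simp add: P_def)
    qed (rule P_in)
    moreover have "contractive n G (P g)"
      by (auto simp: contractive_def P_apply)
    moreover have "superposition n G (P g) (replicate n (P g)) = P g"
    proof
      fix Xs
      show "superposition n G (P g) (replicate n (P g)) Xs = P g Xs"
      proof (cases "Xs \<in> nlists n (Pow G)")
        case True
        then show ?thesis
          using sup[of "replicate n g" Xs g] n by (auto simp: P_apply)
      qed (simp add: P_def superposition_def)
    qed
    moreover have "isotone n G (P g)"
      unfolding isotone_def
    proof (intro ballI impI)
      fix Xs Ys
      assume "Xs \<in> nlists n (Pow G)" "Ys \<in> nlists n (Pow G)" and sub_Ys: "list_all2 (\<subseteq>) Xs Ys"
      moreover have "\<Inter>(set Xs) \<subseteq> \<Inter>(set Ys)"
        using sub_Ys by (fastforce simp: list_all2_conv_all_nth in_set_conv_nth)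
      ultimately show "P g Xs \<subseteq> P g Ys"
        by (auto simp: P_apply)
    qed
    ultimately show ?thesis
      by (simp add: interior_operation_def idempotent_transformation_def)
  qed
  have "superposition n G f gs \<in> P ` G" if f: "f \<in> P ` G" and gs: "gs \<in> nlists n (P ` G)" for f gs
  proof -
    obtain x where x: "x \<in> G" "f = P x"
      using f by blast
    have "gs \<in> lists (P ` G)" "length gs = n"
      using gs by (auto simp: nlists_def)
    moreover from this obtain ys where "ys \<in> lists G" "gs = map P ys"
      unfolding lists_image by blast
    ultimately have ys: "ys \<in> nlists n G" "gs = map P ys"
      by (auto simp: nlists_def)
    have "opr x ys \<in> G"
      using x(1) ys(1) by (rule operation_is_meet_closed[OF meet])
    then show ?thesis
      using hom[OF x(1) ys(1)] x ys by (metis imageI)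
  qed
  then have "interior_menger_algebra n G (P ` G)"
    using ne interior by (auto simp: interior_menger_algebra_def)
  moreover have "menger_isomorphic n G opr (P ` G) (superposition n G)"
    using inj hom by (auto simp: menger_isomorphic_def bij_betw_def)
  ultimately show ?thesis
    by (auto simp: isomorphic_to_interior_operations_on_def)
qed

(* HOL cannot quantify over types inside a formula. The existential over sets A therefore ranges
   over sets of elements of the type of G, and the second conjunct adds the
   "only if" direction for sets A over an arbitrary type 'b. *)
theorem corollary6p2:
  fixes n :: nat and G :: "'a set" and opr :: "'a \<Rightarrow> 'a list \<Rightarrow> 'a"
  assumes "n \<ge> 1" and "menger_algebra n G opr"
  shows "((\<exists>A :: 'a set. isomorphic_to_interior_operations_on n G opr A)
            \<longleftrightarrow> derived_from_idem_comm_semigroup n G opr) \<and>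
         ((\<exists>A :: 'b set. isomorphic_to_interior_operations_on n G opr A)
            \<longrightarrow> derived_from_idem_comm_semigroup n G opr)"
proof -
  have ne: "G \<noteq> {}"
    using assms(2) by (simp add: menger_algebra_def)
  have "derived_from_idem_comm_semigroup n G opr"
    if isom: "isomorphic_to_interior_operations_on n G opr A" for A :: "'a set"
    using meet_if_isomorphic_to_interior_operations[OF assms(2) isom]
      derived_if_meet[OF assms(1) ne] by metis
  moreover have "derived_from_idem_comm_semigroup n G opr"
    if isom: "isomorphic_to_interior_operations_on n G opr A" for A :: "'b set"
    using meet_if_isomorphic_to_interior_operations[OF assms(2) isom]
      derived_if_meet[OF assms(1) ne] by metis
  moreover have "isomorphic_to_interior_operations_on n G opr G"
    if "derived_from_idem_comm_semigroup n G opr"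
    using interior_representation_if_meet[OF assms(1) ne] meet_if_derived[OF that] by blast
  ultimately show ?thesis
    by blast
qed

end
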